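(* Let $(V,\mathcal B,\mu)$ be a $\sigma$-finite standard measure space and let $\rho$ be a symmetric irreducible measure on $(V\times V,\mathcal B\times\mathcal B)$. Let $\mathcal G$ be the graph whose vertices are the sets $A\in\mathcal B$ with $\mu(A)<\infty$, two such sets $A$ and $B$ being connected by an edge if $\rho(A\times B)>0$. Then any two sets $A$ and $B$ from the graph $\mathcal G$ are connected by a finite path, i.e. there is a finite sequence $A_0,\dots,A_n$ of vertices of $\mathcal G$ with $A_0=A$, $A_n=B$ and $\rho(A_i\times A_{i+1})>0$ for $i=0,\dots,n-1$. In other words, the graph $\mathcal G$ is connected.
   Context: $(V,\mathcal B)$ is a standard Borel space and $\mu$ a non-atomic $\sigma$-finite positive measure on it. A symmetric measure $\rho$ is a $\sigma$-finite measure on $V\times V$ with $\rho(A\times B)=\rho(B\times A)$ for all $A,B\in\mathcal B$; it is disintegrated as $\iint f\,d\rho=\int_V\left(\int_V f(x,y)\,d\rho_x(y)\right)d\mu(x)$, and it is assumed that $0<c(x):=\rho_x(V)<\infty$ for $\mu$-a.e. $x$. The measure $\rho$ is irreducible if, for the kernel $k(x,\cdot)=\rho_x(\cdot)$ with powers $k^1=k$, $k^n(x,A)=\int_V k^{n-1}(y,A)\,k(x,dy)$, for every $A\in\mathcal B$ with $\mu(A)>0$ and $\mu$-a.e. $x\in V$ there exists $n\ge1$ with $k^n(x,A)>0$. Sets in a measure space are considered modulo sets of measure zero.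
   Formalization: The vertices are taken to be the sets A with 0 < μ(A) < ∞; with null sets allowed as vertices the claim fails, since ρ(A×B) = 0 whenever μ(A) = 0, so such a vertex (e.g. the empty set) is isolated. *)

theory Defs
  imports "HOL-Analysis.Analysis"
begin

definition standard_borel :: "'a measure \<Rightarrow> bool" where
  "standard_borel M \<longleftrightarrow>
     (\<exists>T. completely_metrizable_space T \<and> second_countable T \<and> topspace T = space M \<and>
          sets M = sigma_sets (topspace T) {U. openin T U})"

definition nonatomic :: "'a measure \<Rightarrow> bool" where
  "nonatomic M \<longleftrightarrow>
     (\<forall>A\<in>sets M. 0 < emeasure M A \<longrightarrow>
        (\<exists>B\<in>sets M. B \<subseteq> A \<and> 0 < emeasure M B \<and> emeasure M B < emeasure M A))"

definition symmetric_measure :: "'a measure \<Rightarrow> ('a \<times> 'a) measure \<Rightarrow> bool" where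
  "symmetric_measure M \<rho> \<longleftrightarrow>
     sets \<rho> = sets (M \<Otimes>\<^sub>M M) \<and> sigma_finite_measure \<rho> \<and>
     (\<forall>A\<in>sets M. \<forall>B\<in>sets M. emeasure \<rho> (A \<times> B) = emeasure \<rho> (B \<times> A))"

definition disintegration ::
  "'a measure \<Rightarrow> ('a \<times> 'a) measure \<Rightarrow> ('a \<Rightarrow> 'a measure) \<Rightarrow> bool" where
  "disintegration M \<rho> \<kappa> \<longleftrightarrow>
     (\<forall>x\<in>space M. sets (\<kappa> x) = sets M) \<and>
     (\<forall>A\<in>sets M. (\<lambda>x. emeasure (\<kappa> x) A) \<in> borel_measurable M) \<and>
     (\<forall>f :: 'a \<times> 'a \<Rightarrow> ennreal. f \<in> borel_measurable (M \<Otimes>\<^sub>M M) \<longrightarrow>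
        (\<integral>\<^sup>+ z. f z \<partial>\<rho>) = (\<integral>\<^sup>+ x. (\<integral>\<^sup>+ y. f (x, y) \<partial>\<kappa> x) \<partial>M))"

text \<open>Only the powers with positive exponent matter; the value at exponent 0 is the usual
  identity kernel.\<close>

fun kernel_power :: "('a \<Rightarrow> 'a measure) \<Rightarrow> nat \<Rightarrow> 'a \<Rightarrow> 'a set \<Rightarrow> ennreal" where
  "kernel_power \<kappa> 0 x A = indicator A x"
| "kernel_power \<kappa> (Suc 0) x A = emeasure (\<kappa> x) A"
| "kernel_power \<kappa> (Suc (Suc n)) x A = (\<integral>\<^sup>+ y. kernel_power \<kappa> (Suc n) y A \<partial>\<kappa> x)"

text \<open>Irreducibility of a symmetric measure, expressed through its fibre measures \<open>\<kappa>\<close>.\<close>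

definition irreducible_kernel :: "'a measure \<Rightarrow> ('a \<Rightarrow> 'a measure) \<Rightarrow> bool" where
  "irreducible_kernel M \<kappa> \<longleftrightarrow>
     (\<forall>A\<in>sets M. 0 < emeasure M A \<longrightarrow> (AE x in M. \<exists>n\<ge>1. 0 < kernel_power \<kappa> n x A))"

text \<open>Sets are considered modulo null sets, so the null class plays the role of the empty set
  and is not a vertex: for \<open>A\<close> null one has \<open>\<rho> (A \<times> B) = 0\<close> for every \<open>B\<close>, so it would be an
  isolated point.  For the remaining sets we work with representatives rather than with
  classes; adjacency does not depend on the representatives.\<close>

definition graph_vertices :: "'a measure \<Rightarrow> 'a set set" where
  "graph_vertices M = {A \<in> sets M. 0 < emeasure M A \<and> emeasure M A < \<infinity>}"

definition graph_edge :: "('a \<times> 'a) measure \<Rightarrow> 'a set \<Rightarrow> 'a set \<Rightarrow> bool" where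
  "graph_edge \<rho> A B \<longleftrightarrow> 0 < emeasure \<rho> (A \<times> B)"

end

(* If k^n(x, B) > 0 on a subset of A of positive measure, a path of length n from A to B is found
   by induction on n. For n = 1 this is the disintegration formula
   rho(A x B) = int_A rho_x(B) dmu(x). In the step, the set D of points y with k^(n-1)(y, B) > 0 has
   rho(A x D) > 0; by sigma-finiteness D can be cut down to a set of finite measure, whose measure
   is positive because symmetry makes rho vanish on A x N for mu-null N. Irreducibility supplies
   such an n for every A and B, since there are only countably many exponents. *)

theory Submission
  imports Defs
begin

text \<open>The family \<open>\<kappa>\<close> is known to be measurable only set by set. This
  settles indicators; scaling, sums and monotone limits then reach every nonnegative measurable
  \<open>f\<close>.\<close>

lemma nn_integral_kernel_measurable:
  assumes "\<forall>x\<in>space M. sets (\<kappa> x) = sets M"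
    and "\<forall>A\<in>sets M. (\<lambda>x. emeasure (\<kappa> x) A) \<in> borel_measurable M"
    and "f \<in> borel_measurable M"
  shows "(\<lambda>x. \<integral>\<^sup>+ y. f y \<partial>\<kappa> x) \<in> borel_measurable M"
  using assms(3)
proof (induction f rule: borel_measurable_induct)
  case (cong f g)
  have "(\<integral>\<^sup>+ y. f y \<partial>\<kappa> x) = (\<integral>\<^sup>+ y. g y \<partial>\<kappa> x)" if "x \<in> space M" for x
    by (rule nn_integral_cong) (use that assms(1) cong sets_eq_imp_space_eq in blast)
  then show ?case
    using cong by (simp cong: measurable_cong)
next
  case (set A)
  have "(\<integral>\<^sup>+ y. indicator A y \<partial>\<kappa> x) = emeasure (\<kappa> x) A" if "x \<in> space M" for x
    using that set assms(1) by (simp add: nn_integral_indicator)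
  then show ?case
    using set assms(2) by (simp cong: measurable_cong)
next
  case (mult u c)
  have "(\<integral>\<^sup>+ y. c * u y \<partial>\<kappa> x) = c * (\<integral>\<^sup>+ y. u y \<partial>\<kappa> x)" if "x \<in> space M" for x
    using that mult assms(1) by (intro nn_integral_cmult) (simp cong: measurable_cong_sets)
  then show ?case
    using mult by (simp cong: measurable_cong)
next
  case (add u v)
  have "(\<integral>\<^sup>+ y. v y + u y \<partial>\<kappa> x) = (\<integral>\<^sup>+ y. v y \<partial>\<kappa> x) + (\<integral>\<^sup>+ y. u y \<partial>\<kappa> x)"
    if "x \<in> space M" for x
    using that add assms(1) by (intro nn_integral_add) (simp_all cong: measurable_cong_sets)
  then show ?case
    using add by (simp cong: measurable_cong)
next
  case (seq U)
  have "(\<integral>\<^sup>+ y. (SUP i. U i) y \<partial>\<kappa> x) = (SUP i. \<integral>\<^sup>+ y. U i y \<partial>\<kappa> x)" if "x \<in> space M" for x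
    unfolding SUP_apply
    using that seq assms(1)
    by (intro nn_integral_monotone_convergence_SUP) (simp_all cong: measurable_cong_sets)
  then show ?case
    using seq by (simp cong: measurable_cong)
qed

lemma kernel_power_measurable:
  assumes "disintegration M \<rho> \<kappa>" and "A \<in> sets M"
  shows "(\<lambda>x. kernel_power \<kappa> n x A) \<in> borel_measurable M"
proof (cases n)
  case 0
  then show ?thesis using assms(2) by simp
next
  case (Suc m)
  \<comment> \<open>The recursion by integrals starts at exponent 1, so the induction runs over
    \<open>Suc m\<close> and exponent 0 is treated apart.\<close>
  have "(\<lambda>x. kernel_power \<kappa> (Suc m) x A) \<in> borel_measurable M"
  proof (induction m)
    case 0
    then show ?case using assms by (simp add: disintegration_def)
  next
    case (Suc m)
    then show ?case
      using assms(1) by (simp add: disintegration_def nn_integral_kernel_measurable)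
  qed
  with Suc show ?thesis by simp
qed

text \<open>Disintegrating the indicator of \<open>A \<times> B\<close> gives the integral of
  \<open>emeasure (\<kappa> x) B\<close> over \<open>A\<close>, and a nonnegative integral vanishes
  iff its integrand does a.e. This translates edges into statements about the kernel.\<close>

lemma emeasure_Times_eq_0_iff:
  assumes dis: "disintegration M \<rho> \<kappa>" and sets_\<rho>: "sets \<rho> = sets (M \<Otimes>\<^sub>M M)"
    and A: "A \<in> sets M" and B: "B \<in> sets M"
  shows "emeasure \<rho> (A \<times> B) = 0 \<longleftrightarrow> (AE x in M. x \<in> A \<longrightarrow> emeasure (\<kappa> x) B = 0)"
proof -
  have [measurable]: "(\<lambda>x. emeasure (\<kappa> x) B) \<in> borel_measurable M" "A \<in> sets M"
    using dis A B by (simp_all add: disintegration_def)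
  have AB: "A \<times> B \<in> sets (M \<Otimes>\<^sub>M M)"
    using A B by simp
  have "emeasure \<rho> (A \<times> B) = (\<integral>\<^sup>+ z. indicator (A \<times> B) z \<partial>\<rho>)"
    using AB sets_\<rho> by simp
  also have "\<dots> = (\<integral>\<^sup>+ x. (\<integral>\<^sup>+ y. indicator (A \<times> B) (x, y) \<partial>\<kappa> x) \<partial>M)"
    using dis AB by (simp add: disintegration_def)
  also have "\<dots> = (\<integral>\<^sup>+ x. indicator A x * emeasure (\<kappa> x) B \<partial>M)"
  proof (rule nn_integral_cong)
    fix x assume "x \<in> space M"
    then have "B \<in> sets (\<kappa> x)"
      using dis B by (simp add: disintegration_def)
    then show "(\<integral>\<^sup>+ y. indicator (A \<times> B) (x, y) \<partial>\<kappa> x) = indicator A x * emeasure (\<kappa> x) B"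
      by (simp add: indicator_times nn_integral_cmult)
  qed
  finally show ?thesis
    by (simp add: nn_integral_0_iff_AE indicator_def)
qed

text \<open>The disintegration makes null sets negligible in the first factor; symmetry carries this
  over to the second.\<close>

lemma emeasure_Times_null_right:
  assumes "disintegration M \<rho> \<kappa>" and "symmetric_measure M \<rho>"
    and "A \<in> sets M" and "N \<in> null_sets M"
  shows "emeasure \<rho> (A \<times> N) = 0"
proof -
  have "AE x in M. x \<in> N \<longrightarrow> emeasure (\<kappa> x) A = 0"
    using AE_not_in[OF assms(4)] by eventually_elim simp
  then have "emeasure \<rho> (N \<times> A) = 0"
    using assms by (subst emeasure_Times_eq_0_iff) (auto simp: symmetric_measure_def)
  then show ?thesis
    using assms by (auto simp: symmetric_measure_def)
qed

text \<open>The set \<open>D\<close> met in the induction may have infinite measure, so it need not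
  be a vertex and has to be replaced by a part of it that is one.\<close>

lemma finite_measure_neighbour:
  assumes sf: "sigma_finite_measure M" and sym: "symmetric_measure M \<rho>"
    and dis: "disintegration M \<rho> \<kappa>" and A: "A \<in> sets M" and D: "D \<in> sets M"
    and pos: "graph_edge \<rho> A D"
  obtains E where "E \<in> graph_vertices M" "E \<subseteq> D" "graph_edge \<rho> A E"
proof -
  obtain F :: "nat \<Rightarrow> _" where F: "range F \<subseteq> sets M" "(\<Union>i. F i) = space M"
      "\<And>i. emeasure M (F i) \<noteq> \<infinity>"
    using sigma_finite_measure.sigma_finite[OF sf] by metis
  have FD: "D \<inter> F i \<in> sets M" for i
    using D F(1) by auto
  have "A \<times> D = (\<Union>i. A \<times> (D \<inter> F i))"
    using F(2) sets.sets_into_space[OF D] by auto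
  moreover have "range (\<lambda>i. A \<times> (D \<inter> F i)) \<subseteq> sets \<rho>"
    using A FD sym by (auto simp: symmetric_measure_def)
  \<comment> \<open>If all pieces were \<open>\<rho>\<close>-null, so would be their countable union
    \<open>A \<times> D\<close>.\<close>
  ultimately have "\<not> (\<forall>i. emeasure \<rho> (A \<times> (D \<inter> F i)) = 0)"
    using pos emeasure_UN_eq_0[of \<rho> "\<lambda>i. A \<times> (D \<inter> F i)"] unfolding graph_edge_def by fastforce
  then obtain i where i: "emeasure \<rho> (A \<times> (D \<inter> F i)) \<noteq> 0"
    by blast
  have "emeasure M (D \<inter> F i) \<noteq> 0"
    using i emeasure_Times_null_right[OF dis sym A] FD by blast
  moreover have "emeasure M (D \<inter> F i) < \<infinity>"
    using emeasure_mono[of "D \<inter> F i" "F i" M] F(1,3)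
    by (auto simp: less_top[symmetric] top_unique)
  ultimately show ?thesis
    using that[of "D \<inter> F i"] FD i by (auto simp: graph_vertices_def graph_edge_def zero_less_iff_neq_zero)
qed

text \<open>Induction on \<open>n\<close> with \<open>A\<close> varying: each step moves the start
  of the path to a neighbour of \<open>A\<close> and lowers the exponent by one. Paths are written
  as a reflexive transitive closure so that an edge can be put in front.\<close>

lemma path_of_kernel_power_pos:
  fixes n :: nat
  assumes sf: "sigma_finite_measure M" and sym: "symmetric_measure M \<rho>"
    and dis: "disintegration M \<rho> \<kappa>"
    and A: "A \<in> graph_vertices M" and B: "B \<in> graph_vertices M"
    and pos: "\<not> (AE x in M. x \<in> A \<longrightarrow> kernel_power \<kappa> (Suc n) x B = 0)"
  shows "(\<lambda>A B. B \<in> graph_vertices M \<and> graph_edge \<rho> A B)\<^sup>*\<^sup>* A B"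
  using A pos
proof (induction n arbitrary: A)
  case 0
  then have "graph_edge \<rho> A B"
    using B dis sym emeasure_Times_eq_0_iff[of M \<rho> \<kappa> A B]
    by (simp add: graph_vertices_def graph_edge_def symmetric_measure_def zero_less_iff_neq_zero)
  then show ?case
    using B by (simp add: r_into_rtranclp)
next
  case (Suc n)
  have A: "A \<in> sets M" and B': "B \<in> sets M"
    using Suc.prems B by (auto simp: graph_vertices_def)
  define D where "D = {y \<in> space M. kernel_power \<kappa> (Suc n) y B \<noteq> 0}"
  have meas: "(\<lambda>y. kernel_power \<kappa> (Suc n) y B) \<in> borel_measurable M"
    by (rule kernel_power_measurable[OF dis B'])
  then have D: "D \<in> sets M"
    unfolding D_def by measurable
  \<comment> \<open>The next power integrates a nonnegative function against
    \<open>\<kappa> x\<close>, so it vanishes iff \<open>\<kappa> x\<close> gives no mass to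
    \<open>D\<close>, the set where that function is nonzero.\<close>
  have step: "kernel_power \<kappa> (Suc (Suc n)) x B = 0 \<longleftrightarrow> emeasure (\<kappa> x) D = 0"
    if "x \<in> space M" for x
  proof -
    have sets_eq: "sets (\<kappa> x) = sets M"
      using dis that by (simp add: disintegration_def)
    then have "(\<lambda>y. kernel_power \<kappa> (Suc n) y B) \<in> borel_measurable (\<kappa> x)"
      using meas by (simp cong: measurable_cong_sets)
    then show ?thesis
      using nn_integral_0_iff[of "\<lambda>y. kernel_power \<kappa> (Suc n) y B" "\<kappa> x"]
        sets_eq_imp_space_eq[OF sets_eq]
      by (simp add: D_def)
  qed
  have "\<not> (AE x in M. x \<in> A \<longrightarrow> emeasure (\<kappa> x) D = 0)"
    using Suc.prems(2) step by (simp cong: AE_cong_simp del: kernel_power.simps)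
  then have "graph_edge \<rho> A D"
    using emeasure_Times_eq_0_iff[OF dis _ A D] sym
    by (simp add: graph_edge_def symmetric_measure_def zero_less_iff_neq_zero)
  then obtain E where E: "E \<in> graph_vertices M" "E \<subseteq> D" "graph_edge \<rho> A E"
    using finite_measure_neighbour[OF sf sym dis A D] by blast
  \<comment> \<open>On \<open>E \<subseteq> D\<close> the lower power is nowhere zero and
    \<open>E\<close> is not null, so the induction hypothesis applies with \<open>E\<close> as the
    new start.\<close>
  have "\<not> (AE x in M. x \<in> E \<longrightarrow> kernel_power \<kappa> (Suc n) x B = 0)"
  proof
    assume "AE x in M. x \<in> E \<longrightarrow> kernel_power \<kappa> (Suc n) x B = 0"
    then have "AE x in M. x \<notin> E"
      by eventually_elim (use E(2) in \<open>auto simp: D_def\<close>)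
    then show False
      using E(1) AE_iff_null_sets[of E M] by (auto simp: graph_vertices_def)
  qed
  then have "(\<lambda>A B. B \<in> graph_vertices M \<and> graph_edge \<rho> A B)\<^sup>*\<^sup>* E B"
    by (rule Suc.IH[OF E(1)])
  then show ?case
    using E by (simp add: converse_rtranclp_into_rtranclp)
qed

theorem theorem7p2:
  fixes M :: "'a measure" and \<rho> :: "('a \<times> 'a) measure" and \<kappa> :: "'a \<Rightarrow> 'a measure"
  assumes "standard_borel M" and "sigma_finite_measure M" and "nonatomic M"
    and "symmetric_measure M \<rho>"
    and "disintegration M \<rho> \<kappa>"
    and "AE x in M. 0 < emeasure (\<kappa> x) (space M) \<and> emeasure (\<kappa> x) (space M) < \<infinity>"
    and "irreducible_kernel M \<kappa>"
  shows "\<forall>A\<in>graph_vertices M. \<forall>B\<in>graph_vertices M.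
           \<exists>(n::nat) S. S 0 = A \<and> S n = B \<and> (\<forall>i\<le>n. S i \<in> graph_vertices M) \<and>
             (\<forall>i<n. graph_edge \<rho> (S i) (S (Suc i)))"
proof (intro ballI)
  fix A B assume A: "A \<in> graph_vertices M" and B: "B \<in> graph_vertices M"
  \<comment> \<open>Irreducibility gives an exponent that depends on \<open>x\<close>. If every
    single exponent failed a.e. on \<open>A\<close>, countably many null sets would cover
    \<open>A\<close> up to a null set.\<close>
  have "\<exists>n. \<not> (AE x in M. x \<in> A \<longrightarrow> kernel_power \<kappa> (Suc n) x B = 0)"
  proof (rule ccontr)
    assume "\<not> ?thesis"
    then have "AE x in M. \<forall>n. x \<in> A \<longrightarrow> kernel_power \<kappa> (Suc n) x B = 0"
      unfolding AE_all_countable by blast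
    moreover have "AE x in M. \<exists>n\<ge>1. 0 < kernel_power \<kappa> n x B"
      using assms(7) B by (simp add: irreducible_kernel_def graph_vertices_def)
    ultimately have "AE x in M. x \<notin> A"
    proof eventually_elim
      case (elim x)
      then obtain n where "n \<ge> 1" "0 < kernel_power \<kappa> n x B" by blast
      \<comment> \<open>The bound \<open>n \<ge> 1\<close> excludes exponent 0, leaving the form
        \<open>Suc m\<close> to which \<open>elim(1)\<close> applies.\<close>
      with elim(1) show ?case by (cases n) auto
    qed
    then show False
      using A AE_iff_null_sets[of A M] by (auto simp: graph_vertices_def)
  qed
  then have "(\<lambda>A B. B \<in> graph_vertices M \<and> graph_edge \<rho> A B)\<^sup>*\<^sup>* A B"
    using path_of_kernel_power_pos[OF assms(2,4,5) A B] by blast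
  then obtain n S where S: "S 0 = A" "S n = B"
      "\<And>i. i < n \<Longrightarrow> S (Suc i) \<in> graph_vertices M \<and> graph_edge \<rho> (S i) (S (Suc i))"
    by (auto simp: rtranclp_power relpowp_fun_conv)
  \<comment> \<open>The step relation only asks the target to be a vertex; for \<open>i = 0\<close>
    this comes from \<open>A\<close> itself.\<close>
  have "S i \<in> graph_vertices M" if "i \<le> n" for i
    using that S A by (cases i) auto
  with S show "\<exists>(n::nat) S. S 0 = A \<and> S n = B \<and> (\<forall>i\<le>n. S i \<in> graph_vertices M) \<and>
      (\<forall>i<n. graph_edge \<rho> (S i) (S (Suc i)))"
    by blast
qed

end
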